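(* Let $\omega\in[0,1]$, let $c_w\in(0,1)$, and let $c_A,c_b,c_p$ be constants with $c_A+c_b+c_p\le1$ such that $$\|\Delta\mathbf{A}\|\,\|\mathbf{x}_o\|\le c_A\|\mathbf{r}_p(\mathbf{q}_c)\|,\qquad \|\Delta\mathbf{b}\|\le c_b\|\mathbf{r}_p(\mathbf{q}_c)\|,\qquad \|\mathbf{r}^o_p(\mathbf{q}_o)\|\le c_p\|\mathbf{r}_p(\mathbf{q}_c)\| .$$ If $c_w\ge 1-\omega(1-c_A-c_b-c_p)$, then the warm starting point $\mathbf{q}_w$ satisfies $$\|\mathbf{r}_p(\mathbf{q}_w)\|\le c_w\|\mathbf{r}_p(\mathbf{q}_c)\| .$$
   Context: Norms are Euclidean (spectral norm for matrices). $\mathcal{K}=\mathcal{K}^1\times\cdots\times\mathcal{K}^k\subset\mathbb{R}^n$ is a product of $k$ second-order cones $\{\mathbf{v}\in\mathbb{R}^{n_i}:\mathbf{v}_1\ge\|\mathbf{v}_{2:n_i}\|\}$ (equal to $[0,\infty)$ if $n_i=1$), and $\mathbf{e}=(\mathbf{e}^{(1)},\dots,\mathbf{e}^{(k)})$ with $\mathbf{e}^{(i)}=(1,0,\dots,0)^T\in\mathbb{R}^{n_i}$. Two second-order cone programs "minimize $\mathbf{c}^T\mathbf{x}$ subject to $\mathbf{A}\mathbf{x}=\mathbf{b}$, $\mathbf{x}\in\mathcal{K}$" with the same dimensions and cones are considered: the current problem, with data $\mathbf{A}\in\mathbb{R}^{p\times n},\mathbf{b}\in\mathbb{R}^p,\mathbf{c}\in\mathbb{R}^n$,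 and a previous problem, with data $\mathbf{A}_o,\mathbf{b}_o,\mathbf{c}_o$. Put $\Delta\mathbf{A}=\mathbf{A}-\mathbf{A}_o$, $\Delta\mathbf{b}=\mathbf{b}-\mathbf{b}_o$, $\Delta\mathbf{c}=\mathbf{c}-\mathbf{c}_o$. Let $\mathbf{q}_o=(\mathbf{x}_o,\mathbf{y}_o,\mathbf{s}_o)$, with $\mathbf{x}_o,\mathbf{s}_o\in\mathcal{K}$, $\mathbf{y}_o\in\mathbb{R}^p$, be an inexact solution of the previous problem and its dual (only approximately satisfying the equality constraints). For a point $\mathbf{q}=(\mathbf{x},\mathbf{y},\mathbf{s},\kappa,\tau)$ the primal residual of the current problem is $\mathbf{r}_p(\mathbf{q})=\mathbf{A}\mathbf{x}-\tau\mathbf{b}$; the primal residual of the previous problem at $\mathbf{q}_o$ (with $\tau=1$) is $\mathbf{r}_p^o(\mathbf{q}_o)=\mathbf{A}_o\mathbf{x}_o-\mathbf{b}_o$. The cold starting point is $\mathbf{q}_c=(\mathbf{e},0,\mathbf{e},1,1)$. The warm starting point $\mathbf{q}_w=(\mathbf{x}_w,\mathbf{y}_w,\mathbf{s}_w,\kappa_w,\tau_w)$ is $\mathbf{x}_w=\omega\mathbf{x}_o+(1-\omega)\mathbf{e}$, $\mathbf{y}_w=\omega\mathbf{y}_o$, $\mathbf{s}_w=\omega\mathbf{s}_o+(1-\omega)\mathbf{e}$, $\kappa_w=\mathbf{x}_w^T\mathbf{s}_w/k$, $\tau_w=1$. *)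

theory Defs
  imports "HOL-Analysis.Analysis"
begin

(* The splitting of R^n into k blocks R^(n_1) x ... x R^(n_k) is given by two maps:
   block j is the block containing coordinate j, and head i is the first coordinate of
   block i, so that block (head i) = i. Hence n_i = card {j. block j = i} >= 1 and
   k = CARD('k). The remaining coordinates of block i play the role of 2:n_i; for n_i = 1
   there are none and the cone is [0, infinity). *)

definition soc_product :: "('n::finite \<Rightarrow> 'k::finite) \<Rightarrow> ('k \<Rightarrow> 'n) \<Rightarrow> (real ^ 'n) set" where
  "soc_product block head =
     {v. \<forall>i. v $ head i \<ge> L2_set (\<lambda>j. v $ j) {j. block j = i \<and> j \<noteq> head i}}"

definition cone_unit :: "('n::finite \<Rightarrow> 'k::finite) \<Rightarrow> ('k \<Rightarrow> 'n) \<Rightarrow> real ^ 'n" where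
  "cone_unit block head = (\<chi> j. if j = head (block j) then 1 else 0)"

(* (x, y, s) *)
type_synonym ('n, 'p) pd_point = "(real ^ 'n) \<times> (real ^ 'p) \<times> (real ^ 'n)"

(* (x, y, s, kappa, tau) *)
type_synonym ('n, 'p) hsd_point =
  "(real ^ 'n) \<times> (real ^ 'p) \<times> (real ^ 'n) \<times> real \<times> real"

fun primal_residual ::
    "real ^ 'n ^ 'p \<Rightarrow> real ^ 'p \<Rightarrow> ('n::finite, 'p::finite) hsd_point \<Rightarrow> real ^ 'p" where
  "primal_residual A b (x, y, s, \<kappa>, \<tau>) = A *v x - \<tau> *\<^sub>R b"

fun pd_primal_residual ::
    "real ^ 'n ^ 'p \<Rightarrow> real ^ 'p \<Rightarrow> ('n::finite, 'p::finite) pd_point \<Rightarrow> real ^ 'p" where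
  "pd_primal_residual A b (x, y, s) = A *v x - b"

definition cold_start ::
    "('n::finite \<Rightarrow> 'k::finite) \<Rightarrow> ('k \<Rightarrow> 'n) \<Rightarrow> ('n, 'p::finite) hsd_point" where
  "cold_start block head = (cone_unit block head, 0, cone_unit block head, 1, 1)"

fun warm_start ::
    "('n::finite \<Rightarrow> 'k::finite) \<Rightarrow> ('k \<Rightarrow> 'n) \<Rightarrow> real \<Rightarrow> ('n, 'p::finite) pd_point
     \<Rightarrow> ('n, 'p) hsd_point" where
  "warm_start block head \<omega> (x\<^sub>o, y\<^sub>o, s\<^sub>o) =
     (let e = cone_unit block head;
          x\<^sub>w = \<omega> *\<^sub>R x\<^sub>o + (1 - \<omega>) *\<^sub>R e;
          y\<^sub>w = \<omega> *\<^sub>R y\<^sub>o;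
          s\<^sub>w = \<omega> *\<^sub>R s\<^sub>o + (1 - \<omega>) *\<^sub>R e
      in (x\<^sub>w, y\<^sub>w, s\<^sub>w, (x\<^sub>w \<bullet> s\<^sub>w) / real CARD('k), 1))"

(* The library norm on real^'n^'p is the Frobenius norm, hence the operator norm here. *)
definition spectral_norm :: "real ^ 'n::finite ^ 'p::finite \<Rightarrow> real" where
  "spectral_norm M = onorm (\<lambda>x. M *v x)"

end

theory Submission
  imports Defs
begin

text \<open>
  At $\tau = 1$ the primal residual is an affine function of \<open>x\<close>, and the \<open>x\<close>-part of the warm start is
  a convex combination of the previous solution and the cone unit. Hence the residual of the warm
  start is the same convex combination of the current problem's residuals at these two points
  (\<open>residual_convex_combination\<close>); the one at the cone unit is the residual of the cold start. The
  one at the previous solution is the previous residual, perturbed by the change of the data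
  (\<open>norm_residual_perturbed\<close>), so its norm is at most $c_A + c_b + c_p$ times the cold residual.
  The warm residual is therefore at most $\omega (c_A + c_b + c_p) + (1 - \omega)$ times the cold
  one, and this factor is the lower bound imposed on $c_w$.
\<close>

lemma norm_matrix_vector_le_spectral_norm:
  fixes M :: "real ^ 'n ^ 'p"
  shows "norm (M *v x) \<le> spectral_norm M * norm x"
  unfolding spectral_norm_def by (rule onorm) simp

lemma residual_convex_combination:
  fixes A :: "real ^ 'n ^ 'p"
  shows "A *v (\<omega> *\<^sub>R x + (1 - \<omega>) *\<^sub>R z) - b = \<omega> *\<^sub>R (A *v x - b) + (1 - \<omega>) *\<^sub>R (A *v z - b)"
  by (simp add: matrix_vector_right_distrib matrix_vector_mult_scaleR algebra_simps)

text \<open>The bound is the triangle inequality for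
  $A x - b = (A - A_o) x - (b - b_o) + (A_o x - b_o)$.\<close>

lemma norm_residual_perturbed:
  fixes A A\<^sub>o :: "real ^ 'n ^ 'p"
  shows "norm (A *v x - b)
    \<le> spectral_norm (A - A\<^sub>o) * norm x + norm (b - b\<^sub>o) + norm (A\<^sub>o *v x - b\<^sub>o)"
proof -
  have "A *v x - b = (A - A\<^sub>o) *v x - (b - b\<^sub>o) + (A\<^sub>o *v x - b\<^sub>o)"
    by (simp add: matrix_vector_mult_diff_rdistrib)
  also have "norm \<dots> \<le> norm ((A - A\<^sub>o) *v x) + norm (b - b\<^sub>o) + norm (A\<^sub>o *v x - b\<^sub>o)"
    by (meson add_mono norm_triangle_ineq norm_triangle_ineq4 order_refl order_trans)
  finally show ?thesis
    using norm_matrix_vector_le_spectral_norm[of "A - A\<^sub>o" x] by linarith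
qed

theorem mainTheorem3:
  fixes block :: "'n::finite \<Rightarrow> 'k::finite" and head :: "'k \<Rightarrow> 'n"
    and A A\<^sub>o :: "real ^ 'n ^ 'p::finite" and b b\<^sub>o :: "real ^ 'p"
    and x\<^sub>o s\<^sub>o :: "real ^ 'n" and y\<^sub>o :: "real ^ 'p"
    and q\<^sub>o :: "('n, 'p) pd_point" and q\<^sub>c q\<^sub>w :: "('n, 'p) hsd_point"
    and \<omega> c\<^sub>w c\<^sub>A c\<^sub>b c\<^sub>p :: real
  assumes "\<forall>i. block (head i) = i"
    and "x\<^sub>o \<in> soc_product block head" and "s\<^sub>o \<in> soc_product block head"
    and "q\<^sub>o = (x\<^sub>o, y\<^sub>o, s\<^sub>o)"
    and "q\<^sub>c = cold_start block head"
    and "q\<^sub>w = warm_start block head \<omega> q\<^sub>o"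
    and "\<omega> \<in> {0..1}" and "c\<^sub>w \<in> {0<..<1}"
    and "c\<^sub>A + c\<^sub>b + c\<^sub>p \<le> 1"
    and "spectral_norm (A - A\<^sub>o) * norm x\<^sub>o \<le> c\<^sub>A * norm (primal_residual A b q\<^sub>c)"
    and "norm (b - b\<^sub>o) \<le> c\<^sub>b * norm (primal_residual A b q\<^sub>c)"
    and "norm (pd_primal_residual A\<^sub>o b\<^sub>o q\<^sub>o) \<le> c\<^sub>p * norm (primal_residual A b q\<^sub>c)"
    and "c\<^sub>w \<ge> 1 - \<omega> * (1 - c\<^sub>A - c\<^sub>b - c\<^sub>p)"
  shows "norm (primal_residual A b q\<^sub>w) \<le> c\<^sub>w * norm (primal_residual A b q\<^sub>c)"
proof -
  define e where "e = cone_unit block head"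
  define R where "R = norm (primal_residual A b q\<^sub>c)"
  have R: "R = norm (A *v e - b)"
    by (simp add: R_def e_def assms(5) cold_start_def)
  have \<omega>: "0 \<le> \<omega>" "0 \<le> 1 - \<omega>"
    using assms(7) by auto
  have prev: "norm (A *v x\<^sub>o - b) \<le> (c\<^sub>A + c\<^sub>b + c\<^sub>p) * R"
    using norm_residual_perturbed[of A x\<^sub>o b A\<^sub>o b\<^sub>o] assms(4,10-12)
    by (simp add: R_def[symmetric] algebra_simps)
  have "primal_residual A b q\<^sub>w = A *v (\<omega> *\<^sub>R x\<^sub>o + (1 - \<omega>) *\<^sub>R e) - b"
    by (simp add: assms(4,6) e_def Let_def)
  also have "\<dots> = \<omega> *\<^sub>R (A *v x\<^sub>o - b) + (1 - \<omega>) *\<^sub>R (A *v e - b)"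
    by (rule residual_convex_combination)
  also have "norm \<dots> \<le> \<omega> * norm (A *v x\<^sub>o - b) + (1 - \<omega>) * R"
    using norm_triangle_ineq[of "\<omega> *\<^sub>R (A *v x\<^sub>o - b)" "(1 - \<omega>) *\<^sub>R (A *v e - b)"] \<omega>
    by (simp add: R)
  also have "\<dots> \<le> \<omega> * ((c\<^sub>A + c\<^sub>b + c\<^sub>p) * R) + (1 - \<omega>) * R"
    using mult_left_mono[OF prev \<omega>(1)] by simp
  also have "\<dots> = (1 - \<omega> * (1 - c\<^sub>A - c\<^sub>b - c\<^sub>p)) * R"
    by (simp add: algebra_simps)
  also have "\<dots> \<le> c\<^sub>w * R"
    using assms(13) by (intro mult_right_mono) (simp_all add: R_def)
  finally show ?thesis
    by (simp only: R_def)
qed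

end
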